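(* Let $R$ be a non-local commutative Artinian ring with unity. Then the upper ideal relation graph $\Gamma_U(R)$ is a line graph of some graph if and only if $R\cong F_1\times F_2$ for some fields $F_1$ and $F_2$.
   Context: For a commutative ring $R$ with unity, the upper ideal relation graph $\Gamma_U(R)$ is the simple undirected graph whose vertex set is the set of all non-unit elements of $R$, two distinct vertices $x,y$ being adjacent if and only if there is a non-unit element $z\in R$ such that the principal ideals $(x)$ and $(y)$ are both contained in the principal ideal $(z)$. The line graph $L(H)$ of a simple undirected graph $H$ has vertex set $E(H)$, and two distinct vertices of $L(H)$ are adjacent if and only if the corresponding edges share a common vertex in $H$. A graph is "a line graph of some graph" if it is isomorphic to $L(H)$ for some simple undirected graph $H$. A ring is local if it has exactly one maximal ideal. *)

theory Defs
  imports "HOL-Algebra.Algebra"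
begin

section \<open>Simple undirected graphs\<close>

type_synonym 'v ugraph = "'v set \<times> 'v set set"

abbreviation gverts :: "'v ugraph \<Rightarrow> 'v set" where "gverts \<equiv> fst"
abbreviation gedges :: "'v ugraph \<Rightarrow> 'v set set" where "gedges \<equiv> snd"

text \<open>Graphs may be infinite, and the graph without vertices is allowed.\<close>

definition simple_graph :: "'v ugraph \<Rightarrow> bool" where
  "simple_graph G \<longleftrightarrow> (\<forall>e\<in>gedges G. e \<subseteq> gverts G \<and> card e = 2)"

definition graph_isomorphic :: "'v ugraph \<Rightarrow> 'w ugraph \<Rightarrow> bool" where
  "graph_isomorphic G H \<longleftrightarrow>
     (\<exists>f. bij_betw f (gverts G) (gverts H) \<and>
          (\<forall>x\<in>gverts G. \<forall>y\<in>gverts G. {x, y} \<in> gedges G \<longleftrightarrow> {f x, f y} \<in> gedges H))"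

definition line_graph :: "'v ugraph \<Rightarrow> 'v set ugraph" where
  "line_graph H =
     (gedges H,
      {{e, e'} | e e'. e \<in> gedges H \<and> e' \<in> gedges H \<and> e \<noteq> e' \<and> e \<inter> e' \<noteq> {}})"

text \<open>
  HOL cannot quantify over the vertex type of the graph \<open>H\<close> inside a formula, so \<open>H\<close> has to
  live on a fixed type.  The type \<^typ>\<open>'v \<times> bool\<close> is large enough: isolated vertices of \<open>H\<close> are
  irrelevant, every other vertex is an end of an edge, and edges of \<open>H\<close> correspond to
  vertices of \<open>G\<close>.  Lemma \<open>is_line_graphI\<close> below shows that no graph on any other vertex type
  is lost.
\<close>

definition is_line_graph :: "'v ugraph \<Rightarrow> bool" where
  "is_line_graph G \<longleftrightarrow>
     (\<exists>H :: ('v \<times> bool) ugraph. simple_graph H \<and> graph_isomorphic G (line_graph H))"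

lemma line_graph_edge_iff:
  "{e, e'} \<in> gedges (line_graph H) \<longleftrightarrow>
     e \<in> gedges H \<and> e' \<in> gedges H \<and> e \<noteq> e' \<and> e \<inter> e' \<noteq> {}"
  unfolding line_graph_def by (auto simp: doubleton_eq_iff)

lemma is_line_graphI:
  fixes G :: "'v ugraph" and H :: "'w ugraph"
  assumes H: "simple_graph H" and iso: "graph_isomorphic G (line_graph H)"
  shows "is_line_graph G"
proof -
  obtain f where f: "bij_betw f (gverts G) (gedges H)"
    and fe: "\<And>x y. x \<in> gverts G \<Longrightarrow> y \<in> gverts G \<Longrightarrow>
       {x, y} \<in> gedges G \<longleftrightarrow> {f x, f y} \<in> gedges (line_graph H)"
    using iso unfolding graph_isomorphic_def by (auto simp: line_graph_def)
  have "\<forall>e\<in>gedges H. \<exists>p q. e = {p, q}"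
    using H unfolding simple_graph_def by (metis card_2_iff)
  then obtain p q where pq: "\<And>e. e \<in> gedges H \<Longrightarrow> e = {p e, q e}" by metis
  have "\<forall>v\<in>\<Union>(gedges H). \<exists>x\<in>gverts G. v \<in> f x"
    using f unfolding bij_betw_def by auto
  then obtain c where c: "\<And>v. v \<in> \<Union>(gedges H) \<Longrightarrow> c v \<in> gverts G \<and> v \<in> f (c v)" by metis
  define i where "i v = (c v, v = p (f (c v)))" for v
  have inj: "inj_on i (\<Union>(gedges H))"
  proof (rule inj_onI)
    fix u v assume u: "u \<in> \<Union>(gedges H)" and v: "v \<in> \<Union>(gedges H)" and eq: "i u = i v"
    have 1: "c u = c v" "(u = p (f (c v))) = (v = p (f (c v)))" using eq by (auto simp: i_def)
    have "f (c v) \<in> gedges H" using c[OF v] f unfolding bij_betw_def by auto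
    then have "f (c v) = {p (f (c v)), q (f (c v))}" by (rule pq)
    moreover have "u \<in> f (c v)" "v \<in> f (c v)" using c[OF u] c[OF v] 1(1) by auto
    ultimately show "u = v" using 1(2) by (metis insertE singletonD)
  qed
  let ?H = "(i ` \<Union>(gedges H), (image i) ` gedges H) :: ('v \<times> bool) ugraph"
  have sg: "simple_graph ?H"
    unfolding simple_graph_def
  proof
    fix e assume "e \<in> gedges ?H"
    then obtain d where d: "d \<in> gedges H" "e = i ` d" by auto
    have "inj_on i d" using inj d(1) by (meson Union_upper inj_on_subset)
    then have "card e = 2" using H d unfolding simple_graph_def by (simp add: card_image)
    then show "e \<subseteq> gverts ?H \<and> card e = 2" using d by auto
  qed
  have injE: "inj_on (image i) (gedges H)"
    using inj by (metis inj_on_image)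
  have bij: "bij_betw (\<lambda>x. i ` f x) (gverts G) (gverts (line_graph ?H))"
    using bij_betw_trans[OF f, of "image i" "image i ` gedges H"] injE
    unfolding line_graph_def bij_betw_def comp_def by auto
  have "{x, y} \<in> gedges G \<longleftrightarrow> {i ` f x, i ` f y} \<in> gedges (line_graph ?H)"
    if x: "x \<in> gverts G" and y: "y \<in> gverts G" for x y
  proof -
    have e: "f x \<in> gedges H" "f y \<in> gedges H" using x y f unfolding bij_betw_def by auto
    have "i ` (f x \<inter> f y) = i ` f x \<inter> i ` f y"
      using inj e by (intro inj_on_image_Int) auto
    moreover have "i ` f x = i ` f y \<longleftrightarrow> f x = f y" using injE e by (simp add: inj_on_eq_iff)
    ultimately show ?thesis
      unfolding fe[OF x y] line_graph_edge_iff using e by (auto simp del: image_is_empty)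
  qed
  then have "graph_isomorphic G (line_graph ?H)"
    unfolding graph_isomorphic_def using bij by blast
  then show ?thesis unfolding is_line_graph_def using sg by blast
qed

section \<open>Commutative rings\<close>

locale artinian_cring = cring +
  assumes descending_chain:
    "\<lbrakk>\<And>n :: nat. ideal (C n) R; \<And>n. C (Suc n) \<subseteq> C n\<rbrakk> \<Longrightarrow> \<exists>N. \<forall>n\<ge>N. C n = C N"

definition local_ring :: "('a, 'b) ring_scheme \<Rightarrow> bool" where
  "local_ring R \<longleftrightarrow> (\<exists>!M. maximalideal M R)"

definition upper_ideal_relation_graph :: "('a, 'b) ring_scheme \<Rightarrow> 'a ugraph" where
  "upper_ideal_relation_graph R =
     (carrier R - Units R,
      {{x, y} | x y. x \<in> carrier R - Units R \<and> y \<in> carrier R - Units R \<and> x \<noteq> y \<and>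
         (\<exists>z \<in> carrier R - Units R. PIdl\<^bsub>R\<^esub> x \<subseteq> PIdl\<^bsub>R\<^esub> z \<and> PIdl\<^bsub>R\<^esub> y \<subseteq> PIdl\<^bsub>R\<^esub> z)})"

lemma simple_graph_upper_ideal_relation_graph: "simple_graph (upper_ideal_relation_graph R)"
  unfolding simple_graph_def upper_ideal_relation_graph_def by auto

text \<open>
  As for line graphs, an existential claim about fields has to fix the type of their elements.
  The element type of \<open>R\<close> suffices for the factors of \<open>R\<close>, because each factor embeds into \<open>R\<close>.
\<close>

lemma field_factors_on_type:
  fixes R :: "('a, 'r) ring_scheme" and K :: "('b, 'k) ring_scheme" and L :: "('c, 'l) ring_scheme"
  assumes "field K" "field L" "R \<simeq> RDirProd K L"
  shows "\<exists>(F\<^sub>1 :: 'a ring) (F\<^sub>2 :: 'a ring). field F\<^sub>1 \<and> field F\<^sub>2 \<and> R \<simeq> RDirProd F\<^sub>1 F\<^sub>2"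
proof -
  interpret K: field K by fact
  interpret L: field L by fact
  obtain h where h: "h \<in> ring_iso R (RDirProd K L)"
    using assms(3) unfolding is_ring_iso_def by blast
  define g where "g = inv_into (carrier R) h"
  have g: "inj_on g (carrier K \<times> carrier L)"
    using h unfolding g_def ring_iso_def RDirProd_carrier bij_betw_def by (auto intro: inj_on_inv_into)
  let ?a = "\<lambda>x. g (x, \<zero>\<^bsub>L\<^esub>)" and ?b = "\<lambda>y. g (\<zero>\<^bsub>K\<^esub>, y)"
  have a: "inj_on ?a (carrier K)" and b: "inj_on ?b (carrier L)"
    by (auto intro!: inj_onI dest!: inj_onD[OF g])
  let ?F = "image_ring ?a K" and ?G = "image_ring ?b L"
  have "R \<simeq> RDirProd ?F ?G"
    using ring_iso_set_trans[OF h RDirProd_iso6[OF inj_imp_image_ring_iso[OF a]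
        inj_imp_image_ring_iso[OF b]]]
    unfolding is_ring_iso_def by blast
  then show ?thesis
    using K.inj_imp_image_ring_is_field[OF a] L.inj_imp_image_ring_is_field[OF b] by blast
qed

end

theory Submission
  imports Defs
begin

text \<open>
  Four pairwise adjacent vertices of a line graph are edges through one common vertex, so two
  4-cliques which share two vertices span a clique.  Let \<open>M\<close> and \<open>N\<close> be distinct maximal ideals
  and write \<open>1 = x + y\<close> with \<open>x \<in> M\<close> and \<open>y \<in> N\<close>; no non-unit divides both \<open>x\<close> and \<open>y\<close>.
  If \<open>M \<inter> N\<close> had an element \<open>a \<noteq> 0\<close>, there would be such a pair of 4-cliques, one containing \<open>x\<close>
  and the other \<open>y\<close>: when \<open>c = xy \<noteq> 0\<close>, take \<open>{0, c, x, x\<^sup>2}\<close> and \<open>{0, c, y, y\<^sup>2}\<close>; when \<open>xy = 0\<close>,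
  one of \<open>ax\<close>, \<open>ay\<close> is nonzero, say \<open>c = ax\<close>; take \<open>{0, c, x, x + c}\<close>, which lies in \<open>(x)\<close>, and
  \<open>{0, c, y, y + c}\<close>, which lies in \<open>(y + c)\<close> because \<open>x\<close> and \<open>y\<close> are orthogonal idempotents.
  Hence \<open>M \<inter> N = 0\<close>, and the Chinese remainder theorem gives \<open>R \<cong> R/M \<times> R/N\<close>.

  Conversely, the graph of a product of two fields consists of two complete graphs glued at \<open>0\<close>,
  which is the line graph of a double star whose central edge corresponds to \<open>0\<close>.
\<close>

section \<open>Cliques in line graphs\<close>

definition clique :: "'v ugraph \<Rightarrow> 'v set \<Rightarrow> bool" where
  "clique G A \<longleftrightarrow> A \<subseteq> gverts G \<and> (\<forall>x\<in>A. \<forall>y\<in>A. x \<noteq> y \<longrightarrow> {x, y} \<in> gedges G)"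

text \<open>As \<open>c\<close> misses \<open>v\<close>, the edges \<open>a\<close>,
  \<open>b\<close>, \<open>c\<close> are the sides of a triangle. An edge meeting all three sides
  has both ends among the corners, so it is itself a side.\<close>

lemma no_fourth_edge_on_triangle:
  assumes "card a = 2" "card b = 2" "card c = 2" "card d = 2" and "distinct [a, b, c, d]"
    and "v \<in> a" "v \<in> b" "v \<notin> c" and "a \<inter> c \<noteq> {}" "b \<inter> c \<noteq> {}"
    and "a \<inter> d \<noteq> {}" "b \<inter> d \<noteq> {}" "c \<inter> d \<noteq> {}"
  shows False
proof -
  obtain s where s: "a = {v, s}" "s \<noteq> v" using assms(1,6) by (auto simp: card_2_iff)
  obtain t where t: "b = {v, t}" "t \<noteq> v" using assms(2,7) by (auto simp: card_2_iff)
  have "s \<in> c" "t \<in> c" using assms(8-10) s t by auto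
  moreover have "s \<noteq> t" using assms(5) s t by auto
  ultimately have c: "c = {s, t}" using assms(3) by (auto simp: card_2_iff)
  obtain k l where "d = {k, l}" using assms(4) by (auto simp: card_2_iff)
  then show False using assms(5,11-13) s t c by (auto simp: doubleton_eq_iff)
qed

text \<open>If \<open>a\<close> and \<open>b\<close> meet in \<open>v\<close>, an edge missing
  \<open>v\<close> closes a triangle with them, and the remaining edge rules that out.\<close>

lemma four_meeting_edges_common_vertex:
  assumes card: "\<And>e. e \<in> {a, b, c, d} \<Longrightarrow> card e = 2" and dist: "distinct [a, b, c, d]"
    and meet: "\<And>e e'. e \<in> {a, b, c, d} \<Longrightarrow> e' \<in> {a, b, c, d} \<Longrightarrow> e \<inter> e' \<noteq> {}"
  obtains v where "v \<in> a" "v \<in> b" "v \<in> c" "v \<in> d"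
proof -
  obtain v where v: "v \<in> a" "v \<in> b" using meet[of a b] by auto
  have "v \<in> c"
    using no_fourth_edge_on_triangle[of a b c d v] card dist meet v by (metis insertCI)
  moreover have "v \<in> d"
  proof (rule ccontr)
    assume "v \<notin> d"
    moreover have "distinct [a, b, d, c]" using dist by auto
    ultimately show False
      using no_fourth_edge_on_triangle[of a b d c v] card meet v by (metis insertCI)
  qed
  ultimately show ?thesis using that v by blast
qed

text \<open>The edges assigned to each 4-clique form a star. The two centres agree because the
  distinct edges \<open>f p\<close> and \<open>f q\<close> share only one vertex.\<close>

lemma is_line_graph_cliques:
  assumes "is_line_graph G"
    and A: "clique G {p, q, r, s}" "distinct [p, q, r, s]"
    and B: "clique G {p, q, t, u}" "distinct [p, q, t, u]"
    and "r \<noteq> t"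
  shows "{r, t} \<in> gedges G"
proof -
  obtain H :: "('a \<times> bool) ugraph" and f where H: "simple_graph H"
    and f: "bij_betw f (gverts G) (gedges H)"
    and fe: "\<And>x y. x \<in> gverts G \<Longrightarrow> y \<in> gverts G \<Longrightarrow>
       {x, y} \<in> gedges G \<longleftrightarrow> {f x, f y} \<in> gedges (line_graph H)"
    using assms(1) unfolding is_line_graph_def graph_isomorphic_def
    by (auto simp: line_graph_def)
  have inj: "f x = f y \<longleftrightarrow> x = y" if "x \<in> gverts G" "y \<in> gverts G" for x y
    using f that unfolding bij_betw_def by (auto dest: inj_onD)
  have card: "card (f x) = 2" if "x \<in> gverts G" for x
    using f that H unfolding bij_betw_def simple_graph_def by auto
  have meet: "f x \<inter> f y \<noteq> {}" if "clique G C" "x \<in> C" "y \<in> C" for C x y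
  proof (cases "x = y")
    case True
    then show ?thesis using card[of x] that unfolding clique_def by auto
  next
    case False
    then show ?thesis using that fe unfolding clique_def line_graph_edge_iff by blast
  qed
  have centre: "\<exists>v. v \<in> f w \<and> v \<in> f x \<and> v \<in> f y \<and> v \<in> f z"
    if C: "clique G {w, x, y, z}" "distinct [w, x, y, z]" for w x y z
  proof -
    have "{w, x, y, z} \<subseteq> gverts G" using C unfolding clique_def by simp
    then have d: "distinct [f w, f x, f y, f z]" using C(2) inj by auto
    have c: "card e = 2" if "e \<in> {f w, f x, f y, f z}" for e
      using that card C unfolding clique_def by auto
    have m: "e \<inter> e' \<noteq> {}" if "e \<in> {f w, f x, f y, f z}" "e' \<in> {f w, f x, f y, f z}" for e e'
    proof -
      obtain i j where "i \<in> {w, x, y, z}" "j \<in> {w, x, y, z}" "e = f i" "e' = f j"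
        using \<open>e \<in> _\<close> \<open>e' \<in> _\<close> by blast
      then show ?thesis using meet[OF C(1)] by blast
    qed
    show ?thesis using four_meeting_edges_common_vertex[OF c d m] by blast
  qed
  obtain v where v: "v \<in> f p" "v \<in> f q" "v \<in> f r" using centre[OF A] by blast
  obtain w where w: "w \<in> f p" "w \<in> f q" "w \<in> f t" using centre[OF B] by blast
  have verts: "p \<in> gverts G" "q \<in> gverts G" "r \<in> gverts G" "t \<in> gverts G"
    using A B unfolding clique_def by auto
  have "v = w"
  proof (rule ccontr)
    assume "v \<noteq> w"
    then have "f p = {v, w}" "f q = {v, w}"
      using v w card[of p] card[of q] verts by (auto simp: card_2_iff)
    then show False using inj[of p q] A(2) verts by simp
  qed
  then have "f r \<inter> f t \<noteq> {}" using v w by auto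
  then show ?thesis
    unfolding fe[OF verts(3,4)] line_graph_edge_iff
    using f inj verts assms(6) unfolding bij_betw_def by auto
qed

lemma is_line_graph_two_cliques:
  assumes verts: "gverts G = A \<union> B" and c: "A \<inter> B = {c}"
    and edges: "\<And>x y. x \<in> gverts G \<Longrightarrow> y \<in> gverts G \<Longrightarrow>
       {x, y} \<in> gedges G \<longleftrightarrow> x \<noteq> y \<and> (x \<in> A \<and> y \<in> A \<or> x \<in> B \<and> y \<in> B)"
  shows "is_line_graph G"
proof -
  \<comment> \<open>\<open>Inr True\<close> and \<open>Inr False\<close> are the centres of a double
    star and \<open>Inl x\<close> is a leaf. Since \<open>c\<close> lies in \<open>A\<close>, it
    becomes the edge between the centres.\<close>
  define f where "f x = {if x \<in> A then Inr True else Inr False,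
     if x = c then Inr False else Inl x}" for x
  have inj: "inj_on f (A \<union> B)"
    by (rule inj_onI) (auto simp: f_def doubleton_eq_iff split: if_splits)
  let ?H = "(UNIV, f ` (A \<union> B))"
  have "c \<in> A" using c by auto
  then have "simple_graph ?H"
    unfolding simple_graph_def by (auto simp: f_def card_2_iff)
  moreover have "graph_isomorphic G (line_graph ?H)"
    unfolding graph_isomorphic_def
  proof (intro exI conjI ballI)
    show "bij_betw f (gverts G) (gverts (line_graph ?H))"
      using inj verts by (simp add: line_graph_def bij_betw_def)
    fix x y assume x: "x \<in> gverts G" and y: "y \<in> gverts G"
    have "f x \<inter> f y \<noteq> {} \<longleftrightarrow> x = y \<or> x \<in> A \<and> y \<in> A \<or> x \<in> B \<and> y \<in> B"
      using x y verts c unfolding f_def by auto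
    then show "{x, y} \<in> gedges G \<longleftrightarrow> {f x, f y} \<in> gedges (line_graph ?H)"
      unfolding edges[OF x y] line_graph_edge_iff
      using inj x y verts by (auto dest: inj_onD)
  qed
  ultimately show ?thesis by (rule is_line_graphI)
qed

section \<open>The upper ideal relation graph\<close>

lemma (in ring) exists_maximalideal:
  assumes "\<one> \<noteq> \<zero>"
  obtains M where "maximalideal M R"
proof -
  let ?S = "{I. ideal I R \<and> \<one> \<notin> I}"
  have "\<exists>M\<in>?S. \<forall>I\<in>?S. M \<subseteq> I \<longrightarrow> I = M"
  proof (rule subset_Zorn)
    fix C assume C: "subset.chain ?S C"
    show "\<exists>U\<in>?S. \<forall>I\<in>C. I \<subseteq> U"
    \<comment> \<open>The union of the empty chain is no ideal; the zero ideal bounds it instead,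
      and is proper because \<open>\<one> \<noteq> \<zero>\<close>.\<close>
    proof (cases "C = {}")
      case True
      then show ?thesis using zeroideal assms by auto
    next
      case False
      have "subset.chain {I. ideal I R} C" using C unfolding pred_on.chain_def by auto
      then have "ideal (\<Union>C) R" using chain_Union_is_ideal[of C] False by simp
      then show ?thesis using C unfolding pred_on.chain_def by (intro bexI[of _ "\<Union>C"]) auto
    qed
  qed
  then obtain M where M: "ideal M R" "\<one> \<notin> M"
    and max: "\<And>I. ideal I R \<Longrightarrow> \<one> \<notin> I \<Longrightarrow> M \<subseteq> I \<Longrightarrow> I = M" by blast
  have "maximalideal M R"
  proof (rule maximalidealI[OF M(1)])
    show "carrier R \<noteq> M" using M(2) by auto
    show "J = M \<or> J = carrier R" if "ideal J R" "M \<subseteq> J" for J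
      using max that ideal.one_imp_carrier by blast
  qed
  then show ?thesis by (rule that)
qed

lemma (in ring) maximalideals_sum:
  assumes "maximalideal M R" "maximalideal N R" "M \<noteq> N"
  shows "M <+> N = carrier R"
proof -
  interpret M: maximalideal M R by fact
  interpret N: maximalideal N R by fact
  have I: "ideal (M <+> N) R" by (rule add_ideals) unfold_locales
  have "m = m \<oplus> \<zero>" "m \<in> carrier R" if "m \<in> M" for m using that M.Icarr by auto
  then have subM: "M \<subseteq> M <+> N" using N.zero_closed unfolding set_add_def' by blast
  have "n = \<zero> \<oplus> n" "n \<in> carrier R" if "n \<in> N" for n using that N.Icarr by auto
  then have subN: "N \<subseteq> M <+> N" using M.zero_closed unfolding set_add_def' by blast
  have "M <+> N \<subseteq> carrier R" using I by (simp add: additive_subgroup.a_subset ideal.axioms(1))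
  then show ?thesis
    using M.I_maximal[OF I subM] N.I_maximal[OF I subN] assms(3) by auto
qed

context cring
begin

section \<open>Adjacency as having a common non-unit divisor\<close>

lemma unit_of_mem_PIdl:
  assumes "z \<in> carrier R" "\<one> \<in> PIdl z"
  shows "z \<in> Units R"
  using assms ideal_eq_carrier_iff[of z] cgenideal_ideal[of z] ideal.one_imp_carrier by blast

lemma nonunit_of_mem_ideal:
  assumes "ideal I R" "\<one> \<notin> I" "x \<in> I"
  shows "x \<in> carrier R - Units R"
proof -
  have x: "x \<in> carrier R" using assms ideal.Icarr by metis
  have "PIdl x \<subseteq> I" using cgenideal_minimal assms by blast
  then show ?thesis using x ideal_eq_carrier_iff[OF x] assms(2) by auto
qed

lemma PIdl_subset_iff:
  assumes "x \<in> carrier R" "z \<in> carrier R"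
  shows "PIdl x \<subseteq> PIdl z \<longleftrightarrow> x \<in> PIdl z"
  using assms cgenideal_minimal[OF cgenideal_ideal] cgenideal_self by blast

lemma upper_ideal_relation_graph_edge_iff:
  "{x, y} \<in> gedges (upper_ideal_relation_graph R) \<longleftrightarrow>
     x \<in> carrier R - Units R \<and> y \<in> carrier R - Units R \<and> x \<noteq> y \<and>
     (\<exists>z \<in> carrier R - Units R. x \<in> PIdl z \<and> y \<in> PIdl z)"
  unfolding upper_ideal_relation_graph_def using PIdl_subset_iff
  by (auto simp: doubleton_eq_iff) blast+

text \<open>The generator \<open>z\<close> is a common non-unit divisor of any two elements.\<close>

lemma clique_PIdl:
  assumes "z \<in> carrier R - Units R"
  shows "clique (upper_ideal_relation_graph R) (PIdl z)"
proof -
  have "\<one> \<notin> PIdl z" using unit_of_mem_PIdl assms by auto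
  then have "PIdl z \<subseteq> carrier R - Units R"
    using nonunit_of_mem_ideal cgenideal_ideal assms by blast
  then show ?thesis
    unfolding clique_def upper_ideal_relation_graph_edge_iff
    using assms by (auto simp: upper_ideal_relation_graph_def)
qed

text \<open>A common divisor of \<open>x\<close> and \<open>y\<close> divides their sum, hence is a
  unit.\<close>

lemma comaximal_not_adjacent:
  assumes "x \<oplus> y = \<one>"
  shows "{x, y} \<notin> gedges (upper_ideal_relation_graph R)"
proof
  assume "{x, y} \<in> gedges (upper_ideal_relation_graph R)"
  then obtain z where z: "z \<in> carrier R - Units R" "x \<in> PIdl z" "y \<in> PIdl z"
    unfolding upper_ideal_relation_graph_edge_iff by blast
  then have "\<one> \<in> PIdl z"
    using assms cgenideal_ideal[of z]
    by (metis DiffD1 additive_subgroup.a_closed ideal.axioms(1))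
  then show False using unit_of_mem_PIdl z by auto
qed

section \<open>Comaximal elements as an obstruction to line graphs\<close>

text \<open>The two 4-cliques share \<open>\<zero>\<close> and \<open>c\<close>, so a line graph
  would make \<open>x\<close> and \<open>y\<close> adjacent.\<close>

lemma comaximal_cliques_not_line_graph:
  assumes z: "z \<in> carrier R - Units R" "z' \<in> carrier R - Units R"
    and c: "c \<in> PIdl z" "c \<in> PIdl z'"
    and x: "x \<in> PIdl z" "x' \<in> PIdl z" "distinct [\<zero>, c, x, x']"
    and y: "y \<in> PIdl z'" "y' \<in> PIdl z'" "distinct [\<zero>, c, y, y']"
    and one: "x \<oplus> y = \<one>"
  shows "\<not> is_line_graph (upper_ideal_relation_graph R)"
proof
  assume lg: "is_line_graph (upper_ideal_relation_graph R)"
  have zero: "\<zero> \<in> PIdl z" "\<zero> \<in> PIdl z'"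
    using z cgenideal_ideal additive_subgroup.zero_closed ideal.axioms(1) by blast+
  have cl: "clique (upper_ideal_relation_graph R) {\<zero>, c, x, x'}"
    "clique (upper_ideal_relation_graph R) {\<zero>, c, y, y'}"
    using clique_PIdl[OF z(1)] clique_PIdl[OF z(2)] zero c x y unfolding clique_def by auto
  have "x \<noteq> y"
  proof
    assume "x = y"
    then have "x \<in> PIdl z'" "y \<in> PIdl z'" using y by auto
    then have "\<one> \<in> PIdl z'"
      using one z(2) by (metis DiffD1 additive_subgroup.a_closed cgenideal_ideal ideal.axioms(1))
    then show False using unit_of_mem_PIdl z by auto
  qed
  then show False
    using is_line_graph_cliques[OF lg cl(1) x(3) cl(2) y(3)] comaximal_not_adjacent[OF one]
    by simp
qed

lemma PIdl_memI: "w \<in> carrier R \<Longrightarrow> v = w \<otimes> z \<Longrightarrow> v \<in> PIdl z"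
  unfolding cgenideal_def by blast

lemma orthogonal_comaximal_not_line_graph:
  assumes I: "ideal I R" "\<one> \<notin> I" and J: "ideal J R" "\<one> \<notin> J"
    and x: "x \<in> I" and y: "y \<in> J" and one: "x \<oplus> y = \<one>" and xy: "x \<otimes> y = \<zero>"
    and a: "a \<in> J" "a \<otimes> x \<noteq> \<zero>"
  shows "\<not> is_line_graph (upper_ideal_relation_graph R)"
proof -
  let ?c = "a \<otimes> x"
  have cl: "x \<in> carrier R" "y \<in> carrier R" "a \<in> carrier R"
    using ideal.Icarr[OF I(1)] ideal.Icarr[OF J(1)] x y a by auto
  \<comment> \<open>Multiplying \<open>x \<oplus> y = \<one>\<close> by \<open>x\<close> or by
    \<open>y\<close> removes the mixed term.\<close>
  have xx: "x \<otimes> x = x"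
    using arg_cong[OF one, of "\<lambda>t. x \<otimes> t"] xy cl by (simp add: r_distr)
  have yy: "y \<otimes> y = y"
    using arg_cong[OF one, of "\<lambda>t. t \<otimes> y"] xy cl by (simp add: l_distr)
  have cx: "?c \<otimes> x = ?c" "?c \<otimes> y = \<zero>" using xx xy cl by (simp_all add: m_assoc)
  then have cx': "x \<otimes> ?c = ?c" "y \<otimes> ?c = \<zero>" using m_comm[of _ ?c] cl by simp_all
  have cI: "?c \<in> I" "?c \<in> J"
    using ideal.I_l_closed[OF I(1) x cl(3)] ideal.I_r_closed[OF J(1) a(1) cl(1)] by auto
  have zJ: "y \<oplus> ?c \<in> J"
    using cI y J(1) additive_subgroup.a_closed ideal.axioms(1) by metis
  have notJ: "x \<notin> J"
    using y one J additive_subgroup.a_closed ideal.axioms(1) by metis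
  have notI: "y \<notin> I"
    using x one I additive_subgroup.a_closed ideal.axioms(1) by metis
  have zeroI: "\<zero> \<in> I" "\<zero> \<in> J" using I J additive_subgroup.zero_closed ideal.axioms(1) by metis+
  \<comment> \<open>Both \<open>\<zero>\<close> and \<open>?c\<close> lie in \<open>J\<close>, so
    this separates \<open>x \<oplus> ?c\<close> from them.\<close>
  have xc: "x \<oplus> ?c \<notin> J"
  proof
    assume "x \<oplus> ?c \<in> J"
    then have "(x \<oplus> ?c) \<ominus> ?c \<in> J" using cI J(1)
      by (metis a_minus_def additive_subgroup.a_closed additive_subgroup.a_inv_closed ideal.axioms(1))
    moreover have "(x \<oplus> ?c) \<ominus> ?c = x" using cl by algebra
    ultimately show False using notJ by simp
  qed
  have "y \<oplus> ?c \<noteq> \<zero>"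
  proof
    assume "y \<oplus> ?c = \<zero>"
    then have "y = \<ominus> ?c" using cl by (metis m_closed minus_equality)
    then have "y \<in> I" using cI I additive_subgroup.a_inv_closed ideal.axioms(1) by metis
    then show False using notI by simp
  qed
  moreover have "y \<oplus> ?c \<noteq> ?c"
    using notI zeroI cl by (metis m_closed add.r_cancel_one)
  moreover have "y \<oplus> ?c \<noteq> y" "x \<oplus> ?c \<noteq> x" using a(2) cl by simp_all
  ultimately have dist: "distinct [\<zero>, ?c, x, x \<oplus> ?c]" "distinct [\<zero>, ?c, y, y \<oplus> ?c]"
    using a(2) cI zeroI notI notJ xc by auto
  \<comment> \<open>Multiplication by \<open>y\<close> kills \<open>?c\<close> and fixes
    \<open>y\<close>; multiplication by \<open>x\<close> kills \<open>y\<close> and fixes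
    \<open>?c\<close>.\<close>
  have "y \<otimes> (y \<oplus> ?c) = y" "x \<otimes> (y \<oplus> ?c) = ?c"
    using cl yy cx' xy by (simp_all add: r_distr)
  then have mem: "y \<in> PIdl (y \<oplus> ?c)" "?c \<in> PIdl (y \<oplus> ?c)"
    using PIdl_memI cl by metis+
  have "x \<oplus> ?c = (\<one> \<oplus> a) \<otimes> x" using cl by (simp add: l_distr)
  then have mem': "x \<in> PIdl x" "?c \<in> PIdl x" "x \<oplus> ?c \<in> PIdl x"
    using PIdl_memI cgenideal_self cl by auto
  show ?thesis
    using comaximal_cliques_not_line_graph[OF nonunit_of_mem_ideal[OF I x]
        nonunit_of_mem_ideal[OF J zJ] mem'(2) mem(2) mem'(1,3) dist(1) mem(1) _ dist(2) one]
      cgenideal_self cl by simp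
qed

lemma line_graph_maximalideals_Int:
  assumes lg: "is_line_graph (upper_ideal_relation_graph R)"
    and M: "maximalideal M R" and N: "maximalideal N R" and neq: "M \<noteq> N"
  shows "M \<inter> N = {\<zero>}"
proof (rule ccontr)
  assume ne: "M \<inter> N \<noteq> {\<zero>}"
  interpret M: maximalideal M R by fact
  interpret N: maximalideal N R by fact
  have M1: "\<one> \<notin> M" and N1: "\<one> \<notin> N"
    using M.one_imp_carrier M.I_notcarr N.one_imp_carrier N.I_notcarr by auto
  obtain a where a: "a \<in> M" "a \<in> N" "a \<noteq> \<zero>"
    using ne M.zero_closed N.zero_closed by blast
  have "\<one> \<in> M <+> N" using maximalideals_sum[OF M N neq] by simp
  then obtain x y where x: "x \<in> M" and y: "y \<in> N" and one: "x \<oplus> y = \<one>"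
    unfolding set_add_def' by auto
  have cl: "x \<in> carrier R" "y \<in> carrier R" "a \<in> carrier R"
    using x y a M.Icarr N.Icarr by auto
  have notN: "x \<notin> N" using y one N1 N.a_closed by metis
  have notM: "y \<notin> M" using x one M1 M.a_closed by metis
  show False
  proof (cases "x \<otimes> y = \<zero>")
    case True
    have "a = a \<otimes> x \<oplus> a \<otimes> y"
      using cl one by (simp add: r_distr[symmetric])
    then consider "a \<otimes> x \<noteq> \<zero>" | "a \<otimes> y \<noteq> \<zero>" using a(3) by fastforce
    then show False
    proof cases
      case 1
      then show False
        using orthogonal_comaximal_not_line_graph[OF M.is_ideal M1 N.is_ideal N1 x y one True a(2)] lg
        by simp
    next
      case 2
      \<comment> \<open>The orthogonal case is symmetric: here \<open>M\<close> and
        \<open>N\<close>, and \<open>x\<close> and \<open>y\<close>, change places.\<close>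
      have "y \<oplus> x = \<one>" "y \<otimes> x = \<zero>" using one True cl by (simp_all add: a_comm m_comm)
      then show False
        using orthogonal_comaximal_not_line_graph[OF N.is_ideal N1 M.is_ideal M1 y x _ _ a(1)] lg 2
        by simp
    qed
  next
    case False
    have c: "x \<otimes> y \<in> M" "x \<otimes> y \<in> N"
      using x y cl M.I_r_closed N.I_l_closed by auto
    \<comment> \<open>Primality keeps \<open>x \<otimes> x\<close> outside \<open>N\<close>, hence
      distinct from \<open>\<zero>\<close> and \<open>x \<otimes> y\<close>; likewise for
      \<open>y \<otimes> y\<close> and \<open>M\<close>.\<close>
    interpret PM: primeideal M R using M by (rule maximalideal_prime)
    interpret PN: primeideal N R using N by (rule maximalideal_prime)
    have sq: "x \<otimes> x \<notin> N" "y \<otimes> y \<notin> M" using PN.I_prime PM.I_prime cl notN notM by blast+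
    \<comment> \<open>For \<open>v\<close> equal to \<open>x\<close> or \<open>y\<close>, the second
      premise is \<open>x \<oplus> y = \<one>\<close> multiplied by \<open>v\<close>.\<close>
    have idem: "v \<otimes> v \<noteq> v" if "v \<in> carrier R" "v \<otimes> v \<oplus> x \<otimes> y = v" for v
    proof
      assume "v \<otimes> v = v"
      then have "v \<oplus> x \<otimes> y = v" using that by simp
      then show False using False that cl by simp
    qed
    have "x \<otimes> x \<oplus> x \<otimes> y = x" using one cl by (simp add: r_distr[symmetric])
    then have "x \<otimes> x \<noteq> x" by (rule idem[OF cl(1)])
    moreover have "y \<otimes> y \<oplus> x \<otimes> y = (x \<oplus> y) \<otimes> y" using cl by (simp add: l_distr a_comm)
    then have "y \<otimes> y \<noteq> y" using one cl by (intro idem) simp_all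
    ultimately have dist: "distinct [\<zero>, x \<otimes> y, x, x \<otimes> x]" "distinct [\<zero>, x \<otimes> y, y, y \<otimes> y]"
      using False c sq notN notM M.zero_closed N.zero_closed by (simp_all, metis+)
    have mem: "x \<otimes> y \<in> PIdl x" "x \<otimes> y \<in> PIdl y" "x \<otimes> x \<in> PIdl x" "y \<otimes> y \<in> PIdl y"
      using PIdl_memI m_comm cl by metis+
    show False
      using comaximal_cliques_not_line_graph[OF nonunit_of_mem_ideal[OF M.is_ideal M1 x]
          nonunit_of_mem_ideal[OF N.is_ideal N1 y] mem(1,2) cgenideal_self[OF cl(1)] mem(3) dist(1)
          cgenideal_self[OF cl(2)] mem(4) dist(2) one] lg
      by simp
  qed
qed

text \<open>Distinct maximal ideals are comaximal, so the Chinese remainder theorem applies; the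
  quotient by the zero ideal is \<open>R\<close> again.\<close>

lemma maximalideals_Int_zero_iso:
  assumes "maximalideal M R" "maximalideal N R" "M \<noteq> N" and "M \<inter> N = {\<zero>}"
  shows "R \<simeq> RDirProd (R Quot M) (R Quot N)"
proof -
  have "R Quot (M \<inter> N) \<simeq> RDirProd (R Quot M) (R Quot N)"
    using assms maximalideals_sum by (intro chinese_remainder_simple) (auto simp: maximalideal_def)
  then show ?thesis
    unfolding assms(4) using ring_iso_trans[OF FactRing_zeroideal(2)] by blast
qed

section \<open>The graph of a product of two fields\<close>

text \<open>A non-unit lies in one of the two ideals together with all its multiples, so adjacent
  vertices lie in a common one. The graph is two cliques glued at \<open>\<zero>\<close>.\<close>

lemma is_line_graph_of_two_PIdl:
  assumes e: "e \<in> carrier R" and d: "d \<in> carrier R"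
    and nonunits: "carrier R - Units R = PIdl e \<union> PIdl d" and zero: "PIdl e \<inter> PIdl d = {\<zero>}"
  shows "is_line_graph (upper_ideal_relation_graph R)"
proof (rule is_line_graph_two_cliques[OF _ zero])
  show verts: "gverts (upper_ideal_relation_graph R) = PIdl e \<union> PIdl d"
    using nonunits by (simp add: upper_ideal_relation_graph_def)
  fix x y assume "x \<in> gverts (upper_ideal_relation_graph R)" "y \<in> gverts (upper_ideal_relation_graph R)"
  then have xy: "x \<in> carrier R - Units R" "y \<in> carrier R - Units R"
    unfolding verts nonunits by auto
  have "PIdl z \<subseteq> PIdl e \<or> PIdl z \<subseteq> PIdl d" if "z \<in> carrier R - Units R" for z
    using that nonunits cgenideal_minimal cgenideal_ideal e d by blast
  moreover have "e \<in> carrier R - Units R" "d \<in> carrier R - Units R"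
    using nonunits cgenideal_self e d by auto
  ultimately show "{x, y} \<in> gedges (upper_ideal_relation_graph R) \<longleftrightarrow>
    x \<noteq> y \<and> (x \<in> PIdl e \<and> y \<in> PIdl e \<or> x \<in> PIdl d \<and> y \<in> PIdl d)"
    unfolding upper_ideal_relation_graph_edge_iff using xy by blast
qed

lemma is_line_graph_of_field_product:
  assumes "field K" "field L" "R \<simeq> RDirProd K L"
  shows "is_line_graph (upper_ideal_relation_graph R)"
proof -
  interpret K: field K by fact
  interpret L: field L by fact
  obtain h where h: "h \<in> ring_iso R (RDirProd K L)"
    using assms(3) unfolding is_ring_iso_def by blast
  \<comment> \<open>The coordinates of the isomorphism; computing with them avoids transporting the
    graph to the product ring.\<close>
  define p q where "p x = fst (h x)" and "q x = snd (h x)" for x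
  have pc: "p x \<in> carrier K" and qc: "q x \<in> carrier L" if "x \<in> carrier R" for x
    using ring_iso_memE(1)[OF h that] by (auto simp: RDirProd_carrier p_def q_def)
  have pm: "p (x \<otimes> y) = p x \<otimes>\<^bsub>K\<^esub> p y" and qm: "q (x \<otimes> y) = q x \<otimes>\<^bsub>L\<^esub> q y"
    if "x \<in> carrier R" "y \<in> carrier R" for x y
    using ring_iso_memE(2)[OF h that]
    by (auto simp: RDirProd_def DirProd_def monoid.defs p_def q_def split: prod.splits)
  have p1: "p \<one> = \<one>\<^bsub>K\<^esub>" and q1: "q \<one> = \<one>\<^bsub>L\<^esub>"
    using ring_iso_memE(4)[OF h]
    by (auto simp: RDirProd_def DirProd_def monoid.defs p_def q_def)
  have bij: "bij_betw h (carrier R) (carrier K \<times> carrier L)"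
    using ring_iso_memE(5)[OF h] by (simp add: RDirProd_carrier)
  have eqI: "x = y" if "x \<in> carrier R" "y \<in> carrier R" "p x = p y" "q x = q y" for x y
    using bij that unfolding bij_betw_def p_def q_def by (auto intro: inj_onD prod_eqI)
  have ex: "\<exists>x\<in>carrier R. p x = k \<and> q x = l" if "k \<in> carrier K" "l \<in> carrier L" for k l
  proof -
    have "(k, l) \<in> h ` carrier R" using bij that unfolding bij_betw_def by simp
    then obtain x where "x \<in> carrier R" "h x = (k, l)" by auto
    then show ?thesis unfolding p_def q_def by (intro bexI[of _ x]) auto
  qed
  have "h \<zero> = \<zero>\<^bsub>RDirProd K L\<^esub>"
    using h ring_axioms RDirProd_ring[OF K.ring_axioms L.ring_axioms]
    by (auto intro: ring_hom_zero simp: ring_iso_def)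
  then have p0: "p \<zero> = \<zero>\<^bsub>K\<^esub>" and q0: "q \<zero> = \<zero>\<^bsub>L\<^esub>"
    by (auto simp: RDirProd_def DirProd_def monoid.defs p_def q_def)
  have unit: "x \<in> Units R \<longleftrightarrow> p x \<noteq> \<zero>\<^bsub>K\<^esub> \<and> q x \<noteq> \<zero>\<^bsub>L\<^esub>" if x: "x \<in> carrier R" for x
  proof
    assume "x \<in> Units R"
    then obtain w where w: "w \<in> carrier R" "w \<otimes> x = \<one>" using Units_l_inv_ex by blast
    show "p x \<noteq> \<zero>\<^bsub>K\<^esub> \<and> q x \<noteq> \<zero>\<^bsub>L\<^esub>"
      using pm[OF w(1) x] qm[OF w(1) x] w p1 q1 pc[OF w(1)] qc[OF w(1)] by auto
  next
    assume "p x \<noteq> \<zero>\<^bsub>K\<^esub> \<and> q x \<noteq> \<zero>\<^bsub>L\<^esub>"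
    then have "p x \<in> Units K" "q x \<in> Units L"
      using K.field_Units L.field_Units pc[OF x] qc[OF x] by auto
    then obtain k l where kl: "k \<in> carrier K" "k \<otimes>\<^bsub>K\<^esub> p x = \<one>\<^bsub>K\<^esub>"
      "l \<in> carrier L" "l \<otimes>\<^bsub>L\<^esub> q x = \<one>\<^bsub>L\<^esub>"
      using K.Units_l_inv_ex L.Units_l_inv_ex by metis
    \<comment> \<open>The inverse is assembled from inverses in the two coordinates.\<close>
    obtain w where w: "w \<in> carrier R" "p w = k" "q w = l" using ex kl by blast
    then have "w \<otimes> x = \<one>" using kl x by (intro eqI) (simp_all add: pm qm p1 q1)
    then show "x \<in> Units R" using w x m_comm unfolding Units_def by auto
  qed
  \<comment> \<open>The idempotents \<open>e\<close> and \<open>d\<close> correspond to (1,0) and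
    (0,1), and generate the ideals of elements with vanishing second and first coordinate.\<close>
  obtain e where e: "e \<in> carrier R" "p e = \<one>\<^bsub>K\<^esub>" "q e = \<zero>\<^bsub>L\<^esub>" using ex by blast
  obtain d where d: "d \<in> carrier R" "p d = \<zero>\<^bsub>K\<^esub>" "q d = \<one>\<^bsub>L\<^esub>" using ex by blast
  have E: "PIdl e = {x \<in> carrier R. q x = \<zero>\<^bsub>L\<^esub>}"
  proof -
    have "x = x \<otimes> e" if "x \<in> carrier R" "q x = \<zero>\<^bsub>L\<^esub>" for x
      using that e pc qc by (intro eqI) (simp_all add: pm qm)
    moreover have "q (x \<otimes> e) = \<zero>\<^bsub>L\<^esub>" if "x \<in> carrier R" for x
      using that e qc by (simp add: qm)
    ultimately show ?thesis using e(1) unfolding cgenideal_def by auto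
  qed
  have D: "PIdl d = {x \<in> carrier R. p x = \<zero>\<^bsub>K\<^esub>}"
  proof -
    have "x = x \<otimes> d" if "x \<in> carrier R" "p x = \<zero>\<^bsub>K\<^esub>" for x
      using that d pc qc by (intro eqI) (simp_all add: pm qm)
    moreover have "p (x \<otimes> d) = \<zero>\<^bsub>K\<^esub>" if "x \<in> carrier R" for x
      using that d pc by (simp add: pm)
    ultimately show ?thesis using d(1) unfolding cgenideal_def by auto
  qed
  show ?thesis
  proof (rule is_line_graph_of_two_PIdl[OF e(1) d(1)])
    show "carrier R - Units R = PIdl e \<union> PIdl d" unfolding E D using unit by auto
    show "PIdl e \<inter> PIdl d = {\<zero>}" unfolding E D using eqI p0 q0 by auto
  qed
qed

end

theorem theorem2p1:
  fixes R :: "('a, 'b) ring_scheme" (structure)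
  assumes "artinian_cring R"
    and "\<one> \<noteq> \<zero>"
    and "\<not> local_ring R"
  shows "is_line_graph (upper_ideal_relation_graph R) \<longleftrightarrow>
    (\<exists>(F\<^sub>1 :: 'a ring) (F\<^sub>2 :: 'a ring). field F\<^sub>1 \<and> field F\<^sub>2 \<and> R \<simeq> RDirProd F\<^sub>1 F\<^sub>2)"
proof -
  interpret artinian_cring R by fact
  show ?thesis
  proof
    assume lg: "is_line_graph (upper_ideal_relation_graph R)"
    obtain M where M: "maximalideal M R" using exists_maximalideal[OF assms(2)] .
    \<comment> \<open>Existence holds by the previous step, so non-locality can only mean that
      uniqueness fails.\<close>
    obtain N where N: "maximalideal N R" "M \<noteq> N"
      using assms(3) M unfolding local_ring_def by blast
    have "M \<inter> N = {\<zero>}" by (rule line_graph_maximalideals_Int[OF lg M N])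
    then have "R \<simeq> RDirProd (R Quot M) (R Quot N)"
      by (rule maximalideals_Int_zero_iso[OF M N])
    moreover have "field (R Quot M)" "field (R Quot N)"
      using M N is_cring by (auto intro: maximalideal.quotient_is_field)
    \<comment> \<open>The quotients consist of cosets; \<open>field_factors_on_type\<close> moves
      them to the element type of \<open>R\<close>.\<close>
    ultimately show "\<exists>(F\<^sub>1 :: 'a ring) (F\<^sub>2 :: 'a ring). field F\<^sub>1 \<and> field F\<^sub>2 \<and> R \<simeq> RDirProd F\<^sub>1 F\<^sub>2"
      using field_factors_on_type by blast
  next
    assume "\<exists>(F\<^sub>1 :: 'a ring) (F\<^sub>2 :: 'a ring). field F\<^sub>1 \<and> field F\<^sub>2 \<and> R \<simeq> RDirProd F\<^sub>1 F\<^sub>2"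
    then show "is_line_graph (upper_ideal_relation_graph R)"
      using is_line_graph_of_field_product by blast
  qed
qed

end
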